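(* Let $n\ge 1$, $V\in C^\infty(\mathbb T^n;\mathbb R^n)$ be divergence free with mean zero, $f$ a KPP nonlinearity, $A>0$ and $p\in\mathbb R^n$. If $f'(0)\ge \frac14$, then $$\gamma_A(p)\ge\alpha_A(p).$$ If $f'(0)<\frac14$, this is not true in general: for $n=2$, $V(x_1,x_2)=(v(x_2),0)$ with $v\in C^\infty(\mathbb T^1)$ of mean zero, and $p=(1,0)$, one has $\alpha_A(p)=1+A\max_{\mathbb T^1}v$ and $\gamma_A(p)=A\max_{\mathbb T^1}v+2\sqrt{f'(0)}$, so that $\gamma_A(p)<\alpha_A(p)$ when $f'(0)<\frac14$.
   Context: $\mathbb T^n=\mathbb R^n/\mathbb Z^n$ is the flat torus; functions on it are $\mathbb Z^n$-periodic functions on $\mathbb R^n$. KPP nonlinearity: $f\in C^{1,\epsilon}([0,1])$ for some $\epsilon>0$, $f(0)=f(1)=0$, $f$ is non-increasing on $(1-\epsilon,1)$, and $0<f(s)\le s f'(0)$ for $s\in(0,1)$. $\alpha_A(p)$ (G-equation flame speed) is the unique number such that $|p+DG|+AV(x)\cdot(p+DG)=\alpha_A(p)$ admits approximate periodic viscosity solutions, i.e. for every $\epsilon>0$ there is a continuous periodic $G_\epsilon$ that is a viscosity subsolution with right side $\alpha_A(p)+\epsilon$ and a viscosity supersolution with right side $\alpha_A(p)-\epsilon$. It is given by $\alpha_A(p)=\inf_{\phi\in C^1(\mathbb T^n)}\max_{\mathbb T^n}\{|p+D\phi|+AV\cdot(p+D\phi)\}$. $\beta_A(p)$ is the unique number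 such that $|p+DF|^2+AV(x)\cdot(p+DF)=\beta_A(p)$ admits a periodic viscosity solution. It is given by $\beta_A(p)=\inf_{\phi\in C^1(\mathbb T^n)}\max_{\mathbb T^n}\{|p+D\phi|^2+AV\cdot(p+D\phi)\}$. $\gamma_A(p)=\inf_{\lambda>0}\frac{f'(0)+\beta_A(\lambda p)}{\lambda}$ (F-equation flame speed). *)

theory Defs
  imports "HOL-Analysis.Analysis"
begin

section \<open>Functions on the torus\<close>

definition Zn_periodic :: "('a::euclidean_space \<Rightarrow> 'b) \<Rightarrow> bool" where
  "Zn_periodic g \<longleftrightarrow> (\<forall>x k. (\<forall>b\<in>Basis. k \<bullet> b \<in> \<int>) \<longrightarrow> g (x + k) = g x)"

fun C_diff :: "nat \<Rightarrow> ('a::euclidean_space \<Rightarrow> 'b::real_normed_vector) \<Rightarrow> bool" where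
  "C_diff 0 g \<longleftrightarrow> continuous_on UNIV g"
| "C_diff (Suc k) g \<longleftrightarrow> (\<forall>x. g differentiable (at x)) \<and>
     (\<forall>b\<in>Basis. C_diff k (\<lambda>x. frechet_derivative g (at x) b))"

definition C_infinity :: "('a::euclidean_space \<Rightarrow> 'b::real_normed_vector) \<Rightarrow> bool" where
  "C_infinity g \<longleftrightarrow> (\<forall>k. C_diff k g)"

definition mean_zero :: "('a::euclidean_space \<Rightarrow> 'b::euclidean_space) \<Rightarrow> bool" where
  "mean_zero g \<longleftrightarrow> integral (cbox 0 (\<Sum>b\<in>Basis. b)) g = 0"

definition divergence :: "('a::euclidean_space \<Rightarrow> 'a) \<Rightarrow> 'a \<Rightarrow> real" where
  "divergence V x = (\<Sum>b\<in>Basis. frechet_derivative V (at x) b \<bullet> b)"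

definition periodic_flow :: "(real ^ 'n \<Rightarrow> real ^ 'n) \<Rightarrow> bool" where
  "periodic_flow V \<longleftrightarrow> C_infinity V \<and> Zn_periodic V \<and> (\<forall>x. divergence V x = 0) \<and> mean_zero V"

section \<open>KPP nonlinearities\<close>

text \<open>
  A function on the unit interval is represented by a total function whose values outside the
  interval are irrelevant; its derivative at the end points is one-sided.  For
  \<open>\<epsilon> > 1\<close> the Hoelder condition together with the other conditions cannot be satisfied, so
  the interval in the monotonicity condition always lies in the unit interval.
\<close>

abbreviation deriv01 :: "(real \<Rightarrow> real) \<Rightarrow> real \<Rightarrow> real" where
  "deriv01 f s \<equiv> vector_derivative f (at s within {0..1})"

definition C1_holder01 :: "real \<Rightarrow> (real \<Rightarrow> real) \<Rightarrow> bool" where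
  "C1_holder01 \<epsilon> f \<longleftrightarrow>
     (\<forall>s\<in>{0..1}. f differentiable (at s within {0..1})) \<and>
     (\<exists>C. \<forall>s\<in>{0..1}. \<forall>t\<in>{0..1}. \<bar>deriv01 f s - deriv01 f t\<bar> \<le> C * \<bar>s - t\<bar> powr \<epsilon>)"

definition KPP :: "(real \<Rightarrow> real) \<Rightarrow> bool" where
  "KPP f \<longleftrightarrow> (\<exists>\<epsilon>>0. C1_holder01 \<epsilon> f \<and> f 0 = 0 \<and> f 1 = 0 \<and> antimono_on {1 - \<epsilon><..<1} f \<and>
     (\<forall>s\<in>{0<..<1}. 0 < f s \<and> f s \<le> s * deriv01 f 0))"

section \<open>Viscosity solutions of first-order equations\<close>

text \<open>
  Viscosity inequalities for \<open>H x (D u) \<le> c\<close> and \<open>H x (D u) \<ge> c\<close> on the whole space, with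
  continuously differentiable test functions \<open>\<phi>\<close> whose gradient is \<open>D\<close>.
\<close>

definition viscosity_sub ::
  "('a::euclidean_space \<Rightarrow> 'a \<Rightarrow> real) \<Rightarrow> real \<Rightarrow> ('a \<Rightarrow> real) \<Rightarrow> bool" where
  "viscosity_sub H c u \<longleftrightarrow>
     (\<forall>\<phi> D x\<^sub>0. (\<forall>x. GDERIV \<phi> x :> D x) \<and> continuous_on UNIV D \<and>
        (\<forall>\<^sub>F x in nhds x\<^sub>0. u x - \<phi> x \<le> u x\<^sub>0 - \<phi> x\<^sub>0) \<longrightarrow> H x\<^sub>0 (D x\<^sub>0) \<le> c)"

definition viscosity_super ::
  "('a::euclidean_space \<Rightarrow> 'a \<Rightarrow> real) \<Rightarrow> real \<Rightarrow> ('a \<Rightarrow> real) \<Rightarrow> bool" where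
  "viscosity_super H c u \<longleftrightarrow>
     (\<forall>\<phi> D x\<^sub>0. (\<forall>x. GDERIV \<phi> x :> D x) \<and> continuous_on UNIV D \<and>
        (\<forall>\<^sub>F x in nhds x\<^sub>0. u x - \<phi> x \<ge> u x\<^sub>0 - \<phi> x\<^sub>0) \<longrightarrow> H x\<^sub>0 (D x\<^sub>0) \<ge> c)"

section \<open>Effective quantities and flame speeds\<close>

definition G_hamiltonian :: "real \<Rightarrow> ('a::euclidean_space \<Rightarrow> 'a) \<Rightarrow> 'a \<Rightarrow> 'a \<Rightarrow> 'a \<Rightarrow> real" where
  "G_hamiltonian A V p x q = norm (p + q) + A * (V x \<bullet> (p + q))"

definition F_hamiltonian :: "real \<Rightarrow> ('a::euclidean_space \<Rightarrow> 'a) \<Rightarrow> 'a \<Rightarrow> 'a \<Rightarrow> 'a \<Rightarrow> real" where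
  "F_hamiltonian A V p x q = (norm (p + q))\<^sup>2 + A * (V x \<bullet> (p + q))"

text \<open>
  The effective quantities are introduced relationally: \<open>is_alpha A V p a\<close> says that the
  number \<open>a\<close> has the property characterising \<open>\<alpha>\<^sub>A(p)\<close>, and similarly for
  \<open>\<beta>\<^sub>A(p)\<close> and \<open>\<gamma>\<^sub>A(p)\<close>.  A statement about every such number does not
  depend on uniqueness.
\<close>

definition is_alpha :: "real \<Rightarrow> ('a::euclidean_space \<Rightarrow> 'a) \<Rightarrow> 'a \<Rightarrow> real \<Rightarrow> bool" where
  "is_alpha A V p a \<longleftrightarrow>
     (\<forall>\<epsilon>>0. \<exists>G. continuous_on UNIV G \<and> Zn_periodic G \<and>
        viscosity_sub (G_hamiltonian A V p) (a + \<epsilon>) G \<and>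
        viscosity_super (G_hamiltonian A V p) (a - \<epsilon>) G)"

definition is_beta :: "real \<Rightarrow> ('a::euclidean_space \<Rightarrow> 'a) \<Rightarrow> 'a \<Rightarrow> real \<Rightarrow> bool" where
  "is_beta A V p b \<longleftrightarrow>
     (\<exists>F. continuous_on UNIV F \<and> Zn_periodic F \<and>
        viscosity_sub (F_hamiltonian A V p) b F \<and>
        viscosity_super (F_hamiltonian A V p) b F)"

definition is_gamma ::
  "(real \<Rightarrow> real) \<Rightarrow> real \<Rightarrow> ('a::euclidean_space \<Rightarrow> 'a) \<Rightarrow> 'a \<Rightarrow> real \<Rightarrow> bool" where
  "is_gamma f A V p g \<longleftrightarrow>
     (\<exists>\<beta>. (\<forall>s>0. is_beta A V (s *\<^sub>R p) (\<beta> s)) \<and>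
        g = (INF s\<in>{0<..}. (deriv01 f 0 + \<beta> s) / s))"

definition shear_flow :: "(real \<Rightarrow> real) \<Rightarrow> real ^ 2 \<Rightarrow> real ^ 2" where
  "shear_flow v x = vector [v (x $ 2), 0]"

end

(* Comparison by doubling of variables works for every equation
     N |p + Du| + A V(x) . (p + Du) = c
   with V Lipschitz and N arbitrary: the two viscosity inequalities are tested with the same
   momentum, so the N-terms cancel.  In particular coercivity, which fails for the G-equation, is
   not needed.  Since r <= r^2 + 1/4, a subsolution F of the F-equation for s p with right side b
   gives the subsolution F / s of the G-equation for p with right side (b + f'(0)) / s; comparison
   with approximate solutions of the G-equation yields alpha <= (b + f'(0)) / s for every s > 0.
   For a shear flow both cell problems reduce to |g'| = h on the circle, where h vanishes at the
   maximum of v; comparison makes alpha and beta unique. *)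

theory Submission
  imports Defs
begin

section \<open>Periodic functions\<close>

lemma Zn_periodic_representative:
  fixes x :: "'a::euclidean_space"
  obtains k where "\<And>b. b \<in> Basis \<Longrightarrow> k \<bullet> b \<in> \<int>" "x + k \<in> cbox 0 (\<Sum>b\<in>Basis. b)"
proof
  let ?k = "- (\<Sum>b\<in>Basis. of_int \<lfloor>x \<bullet> b\<rfloor> *\<^sub>R b) :: 'a"
  have k: "?k \<bullet> b = - of_int \<lfloor>x \<bullet> b\<rfloor>" if "b \<in> Basis" for b
    using that by simp
  show "?k \<bullet> b \<in> \<int>" if "b \<in> Basis" for b
    using k[OF that] by simp
  have "0 \<le> (x + ?k) \<bullet> b \<and> (x + ?k) \<bullet> b \<le> 1" if "b \<in> Basis" for b
    unfolding inner_add_left k[OF that] by linarith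
  then show "x + ?k \<in> cbox 0 (\<Sum>b\<in>Basis. b)"
    by (simp add: mem_box)
qed

lemma continuous_Zn_periodic_attains_sup:
  fixes u :: "'a::euclidean_space \<Rightarrow> real"
  assumes "continuous_on UNIV u" "Zn_periodic u"
  obtains y where "\<And>x. u x \<le> u y"
proof -
  let ?C = "cbox 0 (\<Sum>b\<in>Basis. b) :: 'a set"
  have "?C \<noteq> {}"
    by (simp add: box_ne_empty)
  then obtain y where y: "\<And>x. x \<in> ?C \<Longrightarrow> u x \<le> u y"
    using continuous_attains_sup[OF compact_cbox, of 0 "\<Sum>b\<in>Basis. b" u]
      continuous_on_subset[OF assms(1)] by (metis subset_UNIV)
  have "u x \<le> u y" for x
  proof -
    obtain k where "\<And>b. b \<in> Basis \<Longrightarrow> k \<bullet> b \<in> \<int>" "x + k \<in> ?C"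
      using Zn_periodic_representative[of x] by blast
    with y[of "x + k"] assms(2) show ?thesis
      by (simp add: Zn_periodic_def)
  qed
  then show ?thesis ..
qed

lemma continuous_Zn_periodic_bounded:
  fixes u :: "'a::euclidean_space \<Rightarrow> 'b::real_normed_vector"
  assumes "continuous_on UNIV u" "Zn_periodic u"
  obtains B where "B \<ge> 0" "\<And>x. norm (u x) \<le> B"
proof -
  have "continuous_on UNIV (\<lambda>x. norm (u x))" "Zn_periodic (\<lambda>x. norm (u x))"
    using assms by (auto intro: continuous_intros simp: Zn_periodic_def)
  then obtain y where "\<And>x. norm (u x) \<le> norm (u y)"
    using continuous_Zn_periodic_attains_sup by blast
  then show ?thesis
    using that[of "norm (u y)"] by simp
qed

lemma frechet_derivative_Zn_periodic:
  assumes "\<And>x. g differentiable (at x)" "Zn_periodic g"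
  shows "Zn_periodic (\<lambda>x. frechet_derivative g (at x) h)"
  unfolding Zn_periodic_def
proof (intro allI impI)
  fix x k :: 'a
  assume k: "\<forall>b\<in>Basis. k \<bullet> b \<in> \<int>"
  have "(g has_derivative frechet_derivative g (at (x + k))) (at (x + k))"
    using assms(1) frechet_derivative_works by blast
  then have "((\<lambda>x. g (x + k)) has_derivative frechet_derivative g (at (x + k))) (at x)"
    using has_derivative_compose[of "\<lambda>x. x + k" "\<lambda>h. h" x UNIV g]
    by (simp add: has_derivative_add_const)
  moreover have "(\<lambda>x. g (x + k)) = g"
    using assms(2) k by (simp add: Zn_periodic_def)
  ultimately show "frechet_derivative g (at (x + k)) h = frechet_derivative g (at x) h"
    using frechet_derivative_at by metis
qed

text \<open>The partial derivatives are continuous and again periodic, hence bounded; the sum of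
  their bounds dominates the operator norm, and the mean value inequality applies. This provides the
  Lipschitz constant of the flow on which comparison rests.\<close>

lemma C_infinity_Zn_periodic_lipschitz:
  fixes g :: "'a::euclidean_space \<Rightarrow> 'b::real_normed_vector"
  assumes "C_infinity g" "Zn_periodic g"
  obtains L where "L \<ge> 0" "\<And>x y. norm (g x - g y) \<le> L * norm (x - y)"
proof -
  have "C_diff (Suc 0) g"
    using assms(1) unfolding C_infinity_def by blast
  then have diff: "\<And>x. g differentiable (at x)"
    and cont: "\<And>b. b \<in> Basis \<Longrightarrow> continuous_on UNIV (\<lambda>x. frechet_derivative g (at x) b)"
    by auto
  have "\<exists>B. B \<ge> 0 \<and> (\<forall>x. norm (frechet_derivative g (at x) b) \<le> B)" if "b \<in> Basis" for b
    using continuous_Zn_periodic_bounded[OF cont[OF that] frechet_derivative_Zn_periodic[OF diff assms(2)]]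
    by blast
  then obtain B where B: "\<And>b. b \<in> Basis \<Longrightarrow> B b \<ge> 0"
    "\<And>b x. b \<in> Basis \<Longrightarrow> norm (frechet_derivative g (at x) b) \<le> B b"
    by metis
  let ?L = "\<Sum>b\<in>(Basis :: 'a set). B b"
  have der: "(g has_derivative frechet_derivative g (at x)) (at x)" for x
    using diff frechet_derivative_works by blast
  have "norm (frechet_derivative g (at x) h) \<le> ?L * norm h" for x h
  proof -
    interpret linear "frechet_derivative g (at x)"
      using der has_derivative_linear by blast
    have "frechet_derivative g (at x) h = (\<Sum>b\<in>Basis. (h \<bullet> b) *\<^sub>R frechet_derivative g (at x) b)"
      by (subst euclidean_representation[of h, symmetric]) (simp only: sum scale)
    also have "norm \<dots> \<le> (\<Sum>b\<in>Basis. norm h * B b)"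
      by (rule sum_norm_le) (auto intro!: mult_mono B simp: Basis_le_norm)
    finally show ?thesis
      by (simp add: sum_distrib_left mult.commute)
  qed
  then have "onorm (frechet_derivative g (at x)) \<le> ?L" for x
    by (rule onorm_le)
  then have "norm (g x - g y) \<le> ?L * norm (x - y)" for x y
    using der by (intro differentiable_bound[of UNIV]) auto
  moreover have "?L \<ge> 0"
    using B(1) by (simp add: sum_nonneg)
  ultimately show ?thesis
    using that by blast
qed

section \<open>Comparison\<close>

text \<open>Common form of both Hamiltonians, so that comparison and the shear cell problem are each
  treated once.\<close>

definition ham :: "(real \<Rightarrow> real) \<Rightarrow> real \<Rightarrow> ('a::euclidean_space \<Rightarrow> 'a) \<Rightarrow> 'a \<Rightarrow> 'a \<Rightarrow> 'a \<Rightarrow> real" where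
  "ham N A V p x q = N (norm (p + q)) + A * (V x \<bullet> (p + q))"

lemma G_hamiltonian_eq_ham: "G_hamiltonian = ham (\<lambda>r. r)"
  by (simp add: fun_eq_iff G_hamiltonian_def ham_def)

lemma F_hamiltonian_eq_ham: "F_hamiltonian = ham (\<lambda>r. r\<^sup>2)"
  by (simp add: fun_eq_iff F_hamiltonian_def ham_def)

lemma GDERIV_scaled_dist_sq: "GDERIV (\<lambda>x. N * (norm (x - a))\<^sup>2) x :> (2 * N) *\<^sub>R (x - a)"
  unfolding gderiv_def power2_norm_eq_inner
  by (auto intro!: derivative_eq_intros simp: inner_commute algebra_simps fun_eq_iff)

text \<open>A large penalty \<open>N\<close> forces the maximising pair together. Testing the
  maximum against the pair \<open>(x, x)\<close> bounds the penalty term by an increment of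
  \<open>w\<close> over a short distance, which uniform continuity makes small.\<close>

lemma doubled_maximum:
  fixes u w :: "'a::euclidean_space \<Rightarrow> real"
  assumes u: "continuous_on UNIV u" "Zn_periodic u" and w: "continuous_on UNIV w" "Zn_periodic w"
    and "\<eta> > 0"
  obtains N x y where "N > 0" "norm (x - y) \<le> \<eta>" "N * (norm (x - y))\<^sup>2 \<le> \<eta>"
    "\<And>x' y'. u x' - w y' - N * (norm (x' - y'))\<^sup>2 \<le> u x - w y - N * (norm (x - y))\<^sup>2"
proof -
  let ?C = "cbox 0 (\<Sum>b\<in>Basis. b) :: 'a set"
  obtain Bu where Bu: "Bu \<ge> 0" "\<And>x. norm (u x) \<le> Bu"
    using continuous_Zn_periodic_bounded[OF u] by blast
  obtain Bw where Bw: "Bw \<ge> 0" "\<And>x. norm (w x) \<le> Bw"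
    using continuous_Zn_periodic_bounded[OF w] by blast
  define B where "B = 2 * (Bu + Bw)"
  have B: "B \<ge> 0" "\<And>x y. \<bar>u x - w y\<bar> \<le> B / 2" "\<And>x y. \<bar>w x - w y\<bar> \<le> B"
  proof -
    show "B \<ge> 0"
      using Bu(1) Bw(1) by (simp add: B_def)
    show "\<bar>u x - w y\<bar> \<le> B / 2" for x y
      using Bu(2)[of x] Bw(2)[of y] abs_triangle_ineq4[of "u x" "w y"] by (simp add: B_def)
    show "\<bar>w x - w y\<bar> \<le> B" for x y
      using Bw(2)[of x] Bw(2)[of y] Bu(1) abs_triangle_ineq4[of "w x" "w y"] by (simp add: B_def)
  qed
  obtain R where R: "\<And>x. x \<in> ?C \<Longrightarrow> norm x \<le> R"
    using bounded_cbox bounded_iff by metis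
  have "uniformly_continuous_on (cball 0 (R + 1)) w"
    using compact_uniformly_continuous[OF continuous_on_subset[OF w(1)]] by simp
  then obtain d where d: "d > 0"
    "\<And>x y. x \<in> cball 0 (R + 1) \<Longrightarrow> y \<in> cball 0 (R + 1) \<Longrightarrow> dist y x < d \<Longrightarrow> dist (w y) (w x) < \<eta>"
    unfolding uniformly_continuous_on_def using \<open>\<eta> > 0\<close> by meson
  \<comment> \<open>Three demands on the offset: at most 1 to stay in the ball of radius
    \<open>R + 1\<close>, at most \<eta> for the claim, and below the modulus of continuity
    \<open>d\<close>.\<close>
  define r where "r = min (min 1 \<eta>) (d / 2)"
  have r: "r > 0" "r \<le> 1" "r \<le> \<eta>" "r < d"
    using d(1) \<open>\<eta> > 0\<close> by (auto simp: r_def)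
  \<comment> \<open>The penalty at distance \<open>r\<close> becomes \<open>B + 1\<close>, more than
    the oscillation of \<open>u x - w y\<close>, which is at most \<open>B\<close>.\<close>
  define N where "N = (B + 1) / r\<^sup>2"
  have N: "N > 0" "N * r\<^sup>2 = B + 1"
    using B(1) r(1) by (auto simp: N_def)
  \<comment> \<open>With the offset \<open>z = y - x\<close> as second variable, a simultaneous
    lattice shift of \<open>x\<close> and \<open>y\<close> moves \<open>x\<close> alone. So
    \<open>x\<close> can be kept in the unit cube and \<open>z\<close> in a ball, which gives
    compactness.\<close>
  let ?\<psi> = "\<lambda>(x, z). u x - w (x + z) - N * (norm z)\<^sup>2"
  have "continuous_on (?C \<times> cball 0 r) ?\<psi>"
    unfolding case_prod_unfold
    by (intro continuous_intros continuous_on_compose2[OF u(1)] continuous_on_compose2[OF w(1)]) auto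
  moreover have "compact (?C \<times> cball (0::'a) r)"
    by (simp add: compact_Times)
  moreover have "?C \<times> cball (0::'a) r \<noteq> {}"
    using r(1) by (simp add: box_ne_empty)
  ultimately obtain X where X: "X \<in> ?C \<times> cball (0::'a) r"
    "\<forall>Y\<in>?C \<times> cball 0 r. ?\<psi> Y \<le> ?\<psi> X"
    using continuous_attains_sup by blast
  obtain x z where xz: "X = (x, z)"
    by fastforce
  have x: "x \<in> ?C" and z: "norm z \<le> r"
    using X(1) xz by auto
  have max0: "u x' - w (x' + z') - N * (norm z')\<^sup>2 \<le> u x - w (x + z) - N * (norm z)\<^sup>2"
    if "x' \<in> ?C" "norm z' \<le> r" for x' z'
    using X(2) that xz by fastforce
  \<comment> \<open>From the compact set to all pairs: for a short offset \<open>x'\<close> is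
    shifted into the cube, while a long offset loses against the pair \<open>(x, x)\<close>.\<close>
  have max: "u x' - w (x' + z') - N * (norm z')\<^sup>2 \<le> u x - w (x + z) - N * (norm z)\<^sup>2" for x' z'
  proof (cases "norm z' \<le> r")
    case True
    obtain k where k: "\<And>b. b \<in> Basis \<Longrightarrow> k \<bullet> b \<in> \<int>" "x' + k \<in> ?C"
      using Zn_periodic_representative[of x'] by blast
    have "u (x' + k) = u x'" "w (x' + k + z') = w (x' + z')"
      using u(2) w(2) k(1) unfolding Zn_periodic_def by (simp, metis add.assoc add.commute)
    with max0[OF k(2) True] show ?thesis
      by simp
  next
    case False
    then have "r\<^sup>2 \<le> (norm z')\<^sup>2"
      using r(1) by (intro power_mono) auto
    then have "N * r\<^sup>2 \<le> N * (norm z')\<^sup>2"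
      using N(1) by simp
    moreover have "u x - w x \<le> u x - w (x + z) - N * (norm z)\<^sup>2"
      using max0[OF x, of 0] r(1) by simp
    ultimately show ?thesis
      using B(2)[of x' "x' + z'"] B(2)[of x x] N(2) by linarith
  qed
  have "N * (norm z)\<^sup>2 \<le> w x - w (x + z)"
    using max[of x 0] by simp
  also have "\<dots> \<le> \<eta>"
  proof -
    have "norm (x + z) \<le> R + 1"
      using norm_triangle_ineq[of x z] R[OF x] z r(2) by linarith
    then have "dist (w (x + z)) (w x) < \<eta>"
      using R[OF x] z r(4) by (intro d(2)) (simp_all add: dist_norm[of "x + z" x])
    then show ?thesis
      by (simp add: dist_real_def)
  qed
  finally have small: "N * (norm z)\<^sup>2 \<le> \<eta>" .
  show thesis
  proof (rule that[of N x "x + z"])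
    show "u x' - w y' - N * (norm (x' - y'))\<^sup>2 \<le> u x - w (x + z) - N * (norm (x - (x + z)))\<^sup>2" for x' y'
      using max[of x' "y' - x'"] by (simp add: norm_minus_commute)
  qed (use N small z r in auto)
qed

text \<open>At a maximum of \<open>u x - w y - N * (norm (x - y))\<^sup>2\<close> both viscosity inequalities hold
  with the same momentum \<open>(2 * N) *\<^sub>R (x - y)\<close>.\<close>

lemma viscosity_comparison:
  fixes u w :: "'a::euclidean_space \<Rightarrow> real"
  assumes lip: "L \<ge> 0" "\<And>x y. norm (V x - V y) \<le> L * norm (x - y)" and A: "A \<ge> 0"
    and u: "continuous_on UNIV u" "Zn_periodic u" "viscosity_sub (ham \<Phi> A V p) c u"
    and w: "continuous_on UNIV w" "Zn_periodic w" "viscosity_super (ham \<Phi> A V p) c' w"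
  shows "c' \<le> c"
proof -
  have bound: "c' - c \<le> A * L * (norm p + 2) * \<eta>" if \<eta>: "\<eta> > 0" for \<eta>
  proof -
    obtain N x y where N: "N > 0" and xy: "norm (x - y) \<le> \<eta>" "N * (norm (x - y))\<^sup>2 \<le> \<eta>"
      and max: "\<And>x' y'. u x' - w y' - N * (norm (x' - y'))\<^sup>2 \<le> u x - w y - N * (norm (x - y))\<^sup>2"
      using doubled_maximum[OF u(1,2) w(1,2) \<eta>] by blast
    define q where "q = (2 * N) *\<^sub>R (x - y)"
    have "ham \<Phi> A V p x ((2 * N) *\<^sub>R (x - y)) \<le> c"
    proof (rule u(3)[unfolded viscosity_sub_def, rule_format,
          of "\<lambda>x. N * (norm (x - y))\<^sup>2" "\<lambda>x. (2 * N) *\<^sub>R (x - y)"], intro conjI allI)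
      show "\<forall>\<^sub>F x' in nhds x. u x' - N * (norm (x' - y))\<^sup>2 \<le> u x - N * (norm (x - y))\<^sup>2"
      proof (rule always_eventually, rule allI)
        show "u x' - N * (norm (x' - y))\<^sup>2 \<le> u x - N * (norm (x - y))\<^sup>2" for x'
          using max[of x' y] by simp
      qed
    qed (auto intro!: GDERIV_scaled_dist_sq continuous_intros)
    then have sub: "ham \<Phi> A V p x q \<le> c"
      by (simp add: q_def)
    have "ham \<Phi> A V p y ((2 * - N) *\<^sub>R (y - x)) \<ge> c'"
    proof (rule w(3)[unfolded viscosity_super_def, rule_format,
          of "\<lambda>y. - N * (norm (y - x))\<^sup>2" "\<lambda>y. (2 * - N) *\<^sub>R (y - x)"], intro conjI allI)
      show "\<forall>\<^sub>F y' in nhds y. w y' - - N * (norm (y' - x))\<^sup>2 \<ge> w y - - N * (norm (y - x))\<^sup>2"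
      proof (rule always_eventually, rule allI)
        show "w y' - - N * (norm (y' - x))\<^sup>2 \<ge> w y - - N * (norm (y - x))\<^sup>2" for y'
          using max[of x y'] by (simp add: norm_minus_commute)
      qed
    qed (rule GDERIV_scaled_dist_sq, intro continuous_intros)
    moreover have "(2 * - N) *\<^sub>R (y - x) = q"
      by (simp add: q_def algebra_simps)
    ultimately have super: "ham \<Phi> A V p y q \<ge> c'"
      by simp
    \<comment> \<open>Both inequalities carry the same \<open>\<Phi>\<close> term, which drops out
      on subtraction; what remains is the drift taken at two nearby points.\<close>
    have diff: "c' - c \<le> A * ((V y - V x) \<bullet> (p + q))"
      using sub super by (simp add: ham_def algebra_simps inner_diff_left)
    \<comment> \<open>The momentum \<open>q\<close> has norm \<open>2 * N * norm (x - y)\<close> and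
      need not stay bounded as \<eta> tends to 0. The Lipschitz bound contributes another factor
      \<open>norm (x - y)\<close>, and the product \<open>N * (norm (x - y))\<^sup>2\<close> is at
      most \<eta>.\<close>
    have "(V y - V x) \<bullet> (p + q) \<le> L * norm (x - y) * (norm p + norm q)"
      using norm_cauchy_schwarz[of "V y - V x" "p + q"]
        mult_mono[OF lip(2)[of y x] norm_triangle_ineq[of p q]] lip(1)
      by (simp add: norm_minus_commute)
    also have "\<dots> = L * (norm (x - y) * norm p + 2 * (N * (norm (x - y))\<^sup>2))"
    proof -
      have "norm q = 2 * N * norm (x - y)"
        using N by (simp add: q_def)
      then show ?thesis
        by (simp add: algebra_simps power2_eq_square)
    qed
    also have "\<dots> \<le> L * (\<eta> * norm p + 2 * \<eta>)"
      using xy lip(1) by (intro mult_left_mono add_mono mult_right_mono) auto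
    finally have "A * ((V y - V x) \<bullet> (p + q)) \<le> A * (L * (\<eta> * norm p + 2 * \<eta>))"
      using A by (rule mult_left_mono)
    with diff show ?thesis
      by (simp add: algebra_simps)
  qed
  have "((\<lambda>\<eta>. A * L * (norm p + 2) * \<eta>) \<longlongrightarrow> A * L * (norm p + 2) * 0) (at_right 0)"
    by (intro tendsto_intros)
  moreover have "\<forall>\<^sub>F \<eta> in at_right 0. c' - c \<le> A * L * (norm p + 2) * \<eta>"
    using bound by (auto simp: eventually_at_right_less intro: eventually_mono[OF eventually_at_right_less])
  ultimately have "c' - c \<le> A * L * (norm p + 2) * 0"
    by (intro tendsto_lowerbound) auto
  then show ?thesis
    by simp
qed

section \<open>From the F-equation to the G-equation, and uniqueness of the effective
  constants\<close>

lemma viscosity_sub_F_imp_G: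
  assumes "s > 0" and sub: "viscosity_sub (F_hamiltonian A V (s *\<^sub>R p)) b F" and "m \<ge> 1 / 4"
  shows "viscosity_sub (G_hamiltonian A V p) ((m + b) / s) (\<lambda>x. F x / s)"
  unfolding viscosity_sub_def
proof (intro allI impI, elim conjE)
  fix \<phi> D x\<^sub>0
  assume D: "\<forall>x. GDERIV \<phi> x :> D x" "continuous_on UNIV D"
    and max: "\<forall>\<^sub>F x in nhds x\<^sub>0. F x / s - \<phi> x \<le> F x\<^sub>0 / s - \<phi> x\<^sub>0"
  \<comment> \<open>A test function for \<open>F / s\<close>, multiplied by \<open>s\<close>, is a
    test function for \<open>F\<close> at the same point, so the F-inequality holds with momentum
    \<open>s *\<^sub>R (p + D x\<^sub>0)\<close>.\<close>
  have "GDERIV (\<lambda>x. s * \<phi> x) x :> s *\<^sub>R D x" for x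
    using D(1) unfolding gderiv_def by (auto intro!: derivative_eq_intros)
  moreover have "\<forall>\<^sub>F x in nhds x\<^sub>0. F x - s * \<phi> x \<le> F x\<^sub>0 - s * \<phi> x\<^sub>0"
    using max
  proof eventually_elim
    case (elim x)
    then have "s * (F x / s - \<phi> x) \<le> s * (F x\<^sub>0 / s - \<phi> x\<^sub>0)"
      using mult_left_mono[OF elim, of s] \<open>s > 0\<close> by simp
    then show ?case
      using \<open>s > 0\<close> by (simp add: right_diff_distrib)
  qed
  ultimately have "F_hamiltonian A V (s *\<^sub>R p) x\<^sub>0 (s *\<^sub>R D x\<^sub>0) \<le> b"
    by (intro sub[unfolded viscosity_sub_def, rule_format, of "\<lambda>x. s * \<phi> x"] conjI allI
        continuous_intros D(2))
  moreover define r where "r = norm (s *\<^sub>R (p + D x\<^sub>0))"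
  \<comment> \<open>This is \<open>(r - 1 / 2)\<^sup>2 \<ge> 0\<close>, with equality at
    \<open>r = 1 / 2\<close>; it is the origin of the threshold 1/4.\<close>
  moreover have "r \<le> r\<^sup>2 + 1 / 4"
    using zero_le_power2[of "r - 1 / 2"] by (simp add: power2_eq_square algebra_simps)
  ultimately have "r + A * (V x\<^sub>0 \<bullet> (s *\<^sub>R (p + D x\<^sub>0))) \<le> m + b"
    using \<open>m \<ge> 1 / 4\<close> by (simp add: F_hamiltonian_def flip: scaleR_add_right)
  moreover have "r = s * norm (p + D x\<^sub>0)"
    using \<open>s > 0\<close> by (simp add: r_def)
  ultimately have "s * G_hamiltonian A V p x\<^sub>0 (D x\<^sub>0) \<le> m + b"
    by (simp add: G_hamiltonian_def distrib_left mult.left_commute inner_scaleR_right del: scaleR_add_right)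
  then show "G_hamiltonian A V p x\<^sub>0 (D x\<^sub>0) \<le> (m + b) / s"
    using \<open>s > 0\<close> by (simp add: field_simps)
qed

text \<open>The rescaled solution of the F-equation is compared with approximate supersolutions of
  the G-equation, whose error \<epsilon> is arbitrary. Here \<open>m\<close> stands for
  f'(0).\<close>

lemma is_alpha_le_F_speed:
  fixes V :: "real ^ 'n \<Rightarrow> real ^ 'n"
  assumes V: "periodic_flow V" and "A > 0" "s > 0" "m \<ge> 1 / 4"
    and \<alpha>: "is_alpha A V p \<alpha>" and \<beta>: "is_beta A V (s *\<^sub>R p) b"
  shows "\<alpha> \<le> (m + b) / s"
proof (rule field_le_epsilon)
  fix \<epsilon> :: real
  assume "\<epsilon> > 0"
  obtain L where L: "L \<ge> 0" "\<And>x y. norm (V x - V y) \<le> L * norm (x - y)"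
    using C_infinity_Zn_periodic_lipschitz V unfolding periodic_flow_def by blast
  obtain G where G: "continuous_on UNIV G" "Zn_periodic G"
    "viscosity_super (G_hamiltonian A V p) (\<alpha> - \<epsilon>) G"
    using \<alpha> \<open>\<epsilon> > 0\<close> unfolding is_alpha_def by blast
  obtain F where F: "continuous_on UNIV F" "Zn_periodic F"
    "viscosity_sub (F_hamiltonian A V (s *\<^sub>R p)) b F"
    using \<beta> unfolding is_beta_def by blast
  have "continuous_on UNIV (\<lambda>x. F x / s)" "Zn_periodic (\<lambda>x. F x / s)"
    using F \<open>s > 0\<close> by (auto intro!: continuous_intros simp: Zn_periodic_def)
  then have "\<alpha> - \<epsilon> \<le> (m + b) / s"
    using viscosity_comparison[of L V A "\<lambda>x. F x / s" "\<lambda>r. r" p _ G] L G \<open>A > 0\<close>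
      viscosity_sub_F_imp_G[OF \<open>s > 0\<close> F(3) \<open>m \<ge> 1 / 4\<close>]
    by (simp add: G_hamiltonian_eq_ham)
  then show "\<alpha> \<le> (m + b) / s + \<epsilon>"
    by simp
qed

text \<open>Comparison in both directions. Together with one explicit solution, uniqueness yields
  the equivalences for shear flows.\<close>

lemma is_alpha_unique:
  fixes V :: "real ^ 'n \<Rightarrow> real ^ 'n"
  assumes V: "periodic_flow V" and "A > 0" and "is_alpha A V p a" "is_alpha A V p a'"
  shows "a = a'"
proof -
  obtain L where L: "L \<ge> 0" "\<And>x y. norm (V x - V y) \<le> L * norm (x - y)"
    using C_infinity_Zn_periodic_lipschitz V unfolding periodic_flow_def by blast
  have "a \<le> b" if a: "is_alpha A V p a" and b: "is_alpha A V p b" for a b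
  proof (rule field_le_epsilon)
    fix \<epsilon> :: real
    assume "\<epsilon> > 0"
    then have "\<epsilon> / 2 > 0"
      by simp
    then obtain G G' where "continuous_on UNIV G" "Zn_periodic G"
      "viscosity_super (G_hamiltonian A V p) (a - \<epsilon> / 2) G" "continuous_on UNIV G'"
      "Zn_periodic G'" "viscosity_sub (G_hamiltonian A V p) (b + \<epsilon> / 2) G'"
      using a b unfolding is_alpha_def by meson
    then have "a - \<epsilon> / 2 \<le> b + \<epsilon> / 2"
      using viscosity_comparison[of L V A G' "\<lambda>r. r" p _ G] L \<open>A > 0\<close>
      by (simp add: G_hamiltonian_eq_ham)
    then show "a \<le> b + \<epsilon>"
      by simp
  qed
  then show ?thesis
    using assms by (meson order_antisym)
qed

lemma is_beta_unique:
  fixes V :: "real ^ 'n \<Rightarrow> real ^ 'n"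
  assumes V: "periodic_flow V" and "A > 0" and "is_beta A V p b" "is_beta A V p b'"
  shows "b = b'"
proof -
  obtain L where L: "L \<ge> 0" "\<And>x y. norm (V x - V y) \<le> L * norm (x - y)"
    using C_infinity_Zn_periodic_lipschitz V unfolding periodic_flow_def by blast
  have "a \<le> b" if "is_beta A V p a" "is_beta A V p b" for a b
    using that viscosity_comparison[of L V A _ "\<lambda>r. r\<^sup>2" p b _ a] L \<open>A > 0\<close>
    unfolding is_beta_def F_hamiltonian_eq_ham by (meson less_imp_le)
  then show ?thesis
    using assms by (meson order_antisym)
qed

section \<open>The eikonal equation on the circle\<close>

lemma deriv_nonneg_at_right:
  fixes c :: "real \<Rightarrow> real"
  assumes "(c has_real_derivative c') (at x)" "\<forall>\<^sub>F t in at_right x. c x \<le> c t"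
  shows "0 \<le> c'"
proof (rule ccontr)
  assume "\<not> 0 \<le> c'"
  then obtain d where d: "d > 0" "\<And>h. 0 < h \<Longrightarrow> h < d \<Longrightarrow> c (x + h) < c x"
    using has_real_derivative_neg_dec_right[OF assms(1)] by auto
  obtain b where b: "b > x" "\<And>t. x < t \<Longrightarrow> t < b \<Longrightarrow> c x \<le> c t"
    using assms(2) unfolding eventually_at_right_field by auto
  define h where "h = min (b - x) d / 2"
  have "0 < h" "h < d" "x < x + h" "x + h < b"
    using b(1) d(1) by (auto simp: h_def min_def field_simps)
  then show False
    using d(2)[of h] b(2)[of "x + h"] by simp
qed

text \<open>In the applications \<open>\<sigma>\<close> is 1 or -1 and selects the side from which
  \<open>x\<close> is approached, so that both one-sided inequalities at a kink have one
  form.\<close>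

lemma deriv_nonneg_along:
  fixes c :: "real \<Rightarrow> real"
  assumes "(c has_real_derivative c') (at x)" "\<forall>\<^sub>F t in at_right 0. c x \<le> c (x + \<sigma> * t)"
  shows "0 \<le> \<sigma> * c'"
proof -
  have "((\<lambda>t. c (x + \<sigma> * t)) has_real_derivative c' * \<sigma>) (at 0)"
    by (rule DERIV_chain2[where g = "\<lambda>t. x + \<sigma> * t"])
      (use assms(1) in \<open>auto intro!: derivative_eq_intros\<close>)
  from deriv_nonneg_at_right[OF this] show ?thesis
    using assms(2) by (simp add: mult.commute)
qed

lemma eventually_along:
  fixes x \<sigma> :: real
  assumes "\<forall>\<^sub>F y in nhds x. P y"
  shows "\<forall>\<^sub>F t in at_right 0. P (x + \<sigma> * t)"
proof -
  have "((\<lambda>t. x + \<sigma> * t) \<longlongrightarrow> x + \<sigma> * 0) (at_right 0)"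
    by (intro tendsto_intros)
  then have "filterlim (\<lambda>t. x + \<sigma> * t) (nhds x) (at_right 0)"
    by simp
  then show ?thesis
    using assms by (simp add: filterlim_iff)
qed

text \<open>The solution is the distance of an antiderivative of \<open>h\<close> to the lattice generated by its
  increment over one period.  The distance has downward kinks only at the lattice, where
  \<open>h\<close> vanishes.\<close>

lemma periodic_eikonal_solution:
  fixes h :: "real \<Rightarrow> real"
  assumes cont: "continuous_on UNIV h" and per: "\<And>y. h (y + 1) = h y"
    and nonneg: "\<And>y. h y \<ge> 0" and zero: "h y\<^sub>0 = 0"
  obtains g where "continuous_on UNIV g" "\<And>y (k::int). g (y + of_int k) = g y"
    "\<And>y \<phi> d. (\<phi> has_real_derivative d) (at y) \<Longrightarrow>
       \<forall>\<^sub>F x in nhds y. g x - \<phi> x \<le> g y - \<phi> y \<Longrightarrow> \<bar>d\<bar> \<le> h y"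
    "\<And>y \<phi> d. (\<phi> has_real_derivative d) (at y) \<Longrightarrow>
       \<forall>\<^sub>F x in nhds y. g x - \<phi> x \<ge> g y - \<phi> y \<Longrightarrow> \<bar>d\<bar> \<ge> h y"
proof -
  have "isCont h x" for x
    using cont by (simp add: continuous_on_eq_continuous_at)
  then obtain \<Psi> where \<Psi>: "\<And>x. (\<Psi> has_real_derivative h x) (at x)"
    using einterval_antiderivative[of "-\<infinity>" "\<infinity>" h]
    by (auto simp: has_real_derivative_iff_has_vector_derivative)
  \<comment> \<open>Normalised so that the lattice values \<open>T * k\<close> are the values of
    \<open>\<Phi>\<close> at \<open>y\<^sub>0 + k\<close>, that is, at zeros of
    \<open>h\<close>.\<close>
  define \<Phi> where "\<Phi> y = \<Psi> y - \<Psi> y\<^sub>0" for y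
  have \<Phi>: "(\<Phi> has_real_derivative h x) (at x)" for x
    unfolding \<Phi>_def by (auto intro!: derivative_eq_intros \<Psi>)
  have \<Phi>_cont: "continuous_on UNIV \<Phi>"
    using \<Phi> by (auto simp: continuous_on_eq_continuous_at intro: DERIV_isCont)
  have mono: "\<Phi> x \<le> \<Phi> y" if "x \<le> y" for x y
    using \<Phi> nonneg by (intro DERIV_nonneg_imp_nondecreasing[OF that]) blast
  define T where "T = \<Phi> (y\<^sub>0 + 1)"
  have \<Phi>_0: "\<Phi> y\<^sub>0 = 0"
    by (simp add: \<Phi>_def)
  have shift: "\<Phi> (y + 1) = \<Phi> y + T" for y
  proof -
    have "((\<lambda>y. \<Phi> (y + 1) - \<Phi> y) has_real_derivative 0) (at x)" for x
      using DERIV_shift[of \<Phi> "h x" x 1] \<Phi>[of "x + 1"] \<Phi>[of x] per[of x]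
      by (auto intro!: derivative_eq_intros)
    then have "\<Phi> (y + 1) - \<Phi> y = \<Phi> (y\<^sub>0 + 1) - \<Phi> y\<^sub>0"
      using DERIV_isconst_all by blast
    then show ?thesis
      by (simp add: T_def \<Phi>_0)
  qed
  have shift_nat: "\<Phi> (y + of_nat n) = \<Phi> y + of_nat n * T" for y n
  proof (induction n)
    case (Suc n)
    then show ?case
      using shift[of "y + of_nat n"] by (simp add: algebra_simps)
  qed simp
  have shift_int: "\<Phi> (y + of_int k) = \<Phi> y + of_int k * T" for y k
  proof (cases k)
    case (nonneg n)
    then show ?thesis
      using shift_nat[of y n] by simp
  next
    case (neg n)
    then have k: "real_of_int k = - real (Suc n)"
      by simp
    show ?thesis
      using shift_nat[of "y + of_int k" "Suc n"] unfolding k by (simp add: algebra_simps)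
  qed
  \<comment> \<open>If \<open>T = 0\<close>, which means that \<open>h\<close> vanishes identically,
    this is \<open>{0}\<close>: still closed and nonempty.\<close>
  define S where "S = (\<lambda>x. T * x) ` (\<int> :: real set)"
  have S: "closed S" "S \<noteq> {}"
    using closed_scaling[of "\<int> :: real set" T] by (auto simp: S_def)
  define g where "g y = infdist (\<Phi> y) S" for y
  have lip: "\<bar>g x - g y\<bar> \<le> \<bar>\<Phi> x - \<Phi> y\<bar>" for x y
    using infdist_triangle_abs[of "\<Phi> x" S "\<Phi> y"] by (simp add: g_def dist_real_def)
  show thesis
  proof (rule that)
    show "continuous_on UNIV g"
      unfolding g_def by (intro continuous_intros \<Phi>_cont)
    show "g (y + of_int k) = g y" for y and k :: int
    proof -
      \<comment> \<open>A shift by \<open>k\<close> moves both \<open>\<Phi> y\<close> and its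
        nearest lattice point by \<open>k * T\<close>. The reverse inequality is the same statement
        for \<open>-k\<close>.\<close>
      have le: "g (y + of_int k) \<le> g y" for y and k :: int
      proof -
        obtain s where s: "s \<in> S" "g y = dist (\<Phi> y) s"
          unfolding g_def by (rule infdist_attains_inf[OF S])
        then obtain j :: int where "s = T * of_int j"
          by (auto simp: S_def elim: Ints_cases)
        then have "s + of_int k * T = T * of_int (j + k)"
          by (simp add: algebra_simps)
        then have "s + of_int k * T \<in> S"
          unfolding S_def by (metis Ints_of_int imageI)
        then show ?thesis
          using infdist_le[of "s + of_int k * T" S "\<Phi> (y + of_int k)"] s(2)
          by (simp add: g_def shift_int dist_real_def)
      qed
      show ?thesis
        using le[of y k] le[of "y + of_int k" "-k"] by simp
    qed
  next
    fix y \<phi> d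
    assume \<phi>: "(\<phi> has_real_derivative d) (at y)"
      and max: "\<forall>\<^sub>F x in nhds y. g x - \<phi> x \<le> g y - \<phi> y"
    \<comment> \<open>By \<open>lip\<close> and the maximum, \<open>\<phi> + \<Phi>\<close> does not
      fall below its value at \<open>y\<close> to the right, nor \<open>\<phi> - \<Phi>\<close> to
      the left. The two slopes bound \<open>d\<close> from below and above.\<close>
    have "0 \<le> \<sigma> * (d + \<sigma> * h y)" if \<sigma>: "\<sigma> = 1 \<or> \<sigma> = - 1" for \<sigma> :: real
    proof (rule deriv_nonneg_along)
      show "((\<lambda>x. \<phi> x + \<sigma> * \<Phi> x) has_real_derivative d + \<sigma> * h y) (at y)"
        by (auto intro!: derivative_eq_intros \<phi> \<Phi>)
      show "\<forall>\<^sub>F t in at_right 0. \<phi> y + \<sigma> * \<Phi> y \<le> \<phi> (y + \<sigma> * t) + \<sigma> * \<Phi> (y + \<sigma> * t)"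
        using eventually_along[OF max, of \<sigma>] eventually_at_right_less[of "0::real"]
      proof eventually_elim
        case (elim t)
        then show ?case
          using lip[of "y + \<sigma> * t" y] mono[of y "y + \<sigma> * t"] mono[of "y + \<sigma> * t" y] \<sigma> by auto
      qed
    qed
    from this[of 1] this[of "- 1"] show "\<bar>d\<bar> \<le> h y"
      by auto
  next
    fix y \<phi> d
    assume \<phi>: "(\<phi> has_real_derivative d) (at y)"
      and min: "\<forall>\<^sub>F x in nhds y. g x - \<phi> x \<ge> g y - \<phi> y"
    obtain s where s: "s \<in> S" "g y = \<bar>\<Phi> y - s\<bar>"
      unfolding g_def using infdist_attains_inf[OF S] by (metis dist_real_def)
    show "\<bar>d\<bar> \<ge> h y"
    proof (cases "\<Phi> y = s")
      \<comment> \<open>Here \<open>g\<close> vanishes and may have a downward kink, which puts no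
        lower bound on the slope of a test function; so \<open>h y = 0\<close> is shown
        instead.\<close>
      case True
      obtain k :: int where "s = T * of_int k"
        using s(1) by (auto simp: S_def elim: Ints_cases)
      then have k: "\<Phi> (y\<^sub>0 + of_int k) = \<Phi> y"
        using True shift_int[of y\<^sub>0 k] \<Phi>_0 by simp
      have "h y = 0"
      proof (cases "y\<^sub>0 + of_int k = y")
        case True
        \<comment> \<open>\<open>per\<close> shifts by a single period; the shift by
          \<open>k\<close> is read off from \<open>shift_int\<close> and uniqueness of
          derivatives.\<close>
        have "(\<Phi> has_real_derivative h y\<^sub>0) (at (y\<^sub>0 + of_int k))"
        proof -
          have "((\<lambda>x. \<Phi> (x + of_int k)) has_real_derivative h y\<^sub>0) (at y\<^sub>0)"
            unfolding shift_int by (auto intro!: derivative_eq_intros \<Phi>)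
          then show ?thesis
            by (simp add: DERIV_shift)
        qed
        then show ?thesis
          using True \<Phi>[of y] zero DERIV_unique by metis
      next
        case False
        \<comment> \<open>The nondecreasing \<open>\<Phi>\<close> agrees at \<open>y\<close> and
          \<open>y\<^sub>0 + k\<close>, hence is constant in between. Its derivative at
          \<open>y\<close> is evaluated from that side.\<close>
        define \<sigma> where "\<sigma> = sgn (y\<^sub>0 + of_int k - y)"
        have \<sigma>: "\<sigma> = 1 \<or> \<sigma> = - 1" "\<sigma> * \<sigma> = 1"
          using False by (auto simp: \<sigma>_def sgn_if)
        have "0 \<le> \<sigma> * (- \<sigma> * h y)"
        proof (rule deriv_nonneg_along)
          show "((\<lambda>x. - \<sigma> * \<Phi> x) has_real_derivative - \<sigma> * h y) (at y)"
            by (auto intro!: derivative_eq_intros \<Phi>)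
          have "\<forall>\<^sub>F t in at_right 0. t < \<bar>y\<^sub>0 + of_int k - y\<bar>"
            using False by (intro eventually_at_right_real[THEN eventually_mono]) auto
          then show "\<forall>\<^sub>F t in at_right 0. - \<sigma> * \<Phi> y \<le> - \<sigma> * \<Phi> (y + \<sigma> * t)"
          proof eventually_elim
            case (elim t)
            then show ?case
              using mono[of "y + \<sigma> * t" "y\<^sub>0 + of_int k"] mono[of "y\<^sub>0 + of_int k" "y + \<sigma> * t"] k False
              by (auto simp: \<sigma>_def sgn_if split: if_splits)
          qed
        qed
        then have "h y \<le> 0"
          using \<sigma> by auto
        then show ?thesis
          using nonneg[of y] by simp
      qed
      then show ?thesis
        by simp
    next
      case False
      \<comment> \<open>The direction in which \<open>\<Phi>\<close> approaches the nearest lattice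
        point \<open>s\<close>. Until \<open>s\<close> is reached, \<open>g\<close> decreases there
        at least as much as \<open>\<Phi>\<close> moves, which forces the test function to be
        equally steep.\<close>
      define \<sigma> where "\<sigma> = sgn (s - \<Phi> y)"
      have \<sigma>: "\<sigma> = 1 \<or> \<sigma> = - 1"
        using False by (auto simp: \<sigma>_def sgn_if)
      have "0 \<le> \<sigma> * (- d - \<sigma> * h y)"
      proof (rule deriv_nonneg_along)
        show "((\<lambda>x. - \<phi> x - \<sigma> * \<Phi> x) has_real_derivative - d - \<sigma> * h y) (at y)"
          by (auto intro!: derivative_eq_intros \<phi> \<Phi>)
        have "(\<Phi> \<longlongrightarrow> \<Phi> y) (nhds y)"
          using DERIV_isCont[OF \<Phi>] by (simp add: isCont_def tendsto_at_iff_tendsto_nhds)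
        then have "\<forall>\<^sub>F x in nhds y. dist (\<Phi> x) (\<Phi> y) < \<bar>s - \<Phi> y\<bar>"
          using False by (intro tendstoD) auto
        from eventually_along[OF this, of \<sigma>] eventually_along[OF min, of \<sigma>]
          eventually_at_right_less[of "0::real"]
        show "\<forall>\<^sub>F t in at_right 0.
            - \<phi> y - \<sigma> * \<Phi> y \<le> - \<phi> (y + \<sigma> * t) - \<sigma> * \<Phi> (y + \<sigma> * t)"
        proof eventually_elim
          case (elim t)
          have "g (y + \<sigma> * t) \<le> \<bar>\<Phi> (y + \<sigma> * t) - s\<bar>"
            using infdist_le[OF s(1)] by (simp add: g_def dist_real_def)
          then show ?case
            using elim s(2) mono[of y "y + \<sigma> * t"] mono[of "y + \<sigma> * t" y] False
            by (auto simp: \<sigma>_def sgn_if dist_real_def split: if_splits)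
        qed
      qed
      then show ?thesis
        using \<sigma> by auto
    qed
  qed
qed

section \<open>Shear flows\<close>

lemma shear_flow_eq: "shear_flow v = (\<lambda>x. v (x $ 2) *\<^sub>R axis 1 1)"
  by (simp add: fun_eq_iff shear_flow_def vec_eq_iff forall_2 axis_def)

lemma has_derivative_lift_coordinate:
  fixes v :: "real \<Rightarrow> real" and c :: "real ^ 'm"
  assumes "v differentiable (at (x $ i))"
  shows "((\<lambda>x. v (x $ i) *\<^sub>R c) has_derivative
    (\<lambda>h. frechet_derivative v (at (x $ i)) 1 *\<^sub>R (h $ i) *\<^sub>R c)) (at x)"
proof -
  let ?d = "frechet_derivative v (at (x $ i))"
  have v: "(v has_derivative ?d) (at (x $ i))"
    using assms frechet_derivative_works by blast
  have lin: "?d t *\<^sub>R c = ?d 1 *\<^sub>R t *\<^sub>R c" for t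
  proof -
    have "?d t = ?d 1 * t"
      using linear_scale[OF has_derivative_linear[OF v], of t 1] by simp
    then show ?thesis
      by simp
  qed
  have "((\<lambda>x. x $ i) has_derivative (\<lambda>h. h $ i)) (at x)"
    by (intro bounded_linear.has_derivative[OF bounded_linear_vec_nth] has_derivative_ident)
  from has_derivative_scaleR_left[OF has_derivative_compose[OF this v], of c]
  have "((\<lambda>x. v (x $ i) *\<^sub>R c) has_derivative (\<lambda>h. ?d (h $ i) *\<^sub>R c)) (at x)" .
  then show ?thesis
    unfolding lin .
qed

text \<open>The vector \<open>c\<close> is kept arbitrary for the induction: the partial derivative
  in direction \<open>b\<close> is again a lifted function, with the derivative of \<open>v\<close>
  in place of \<open>v\<close> and \<open>(b $ i) *\<^sub>R c\<close> in place of
  \<open>c\<close>.\<close>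

lemma C_diff_lift_coordinate:
  fixes c :: "real ^ 'm" and v :: "real \<Rightarrow> real"
  assumes "C_diff k v"
  shows "C_diff k (\<lambda>x. v (x $ i) *\<^sub>R c)"
  using assms
proof (induction k arbitrary: v c)
  case 0
  then have "continuous_on UNIV v"
    by simp
  then have "continuous_on UNIV (\<lambda>x. v (x $ i) *\<^sub>R c)"
    by (intro continuous_on_scaleR continuous_on_compose2[of UNIV v UNIV "\<lambda>x. x $ i"]
        continuous_intros) auto
  then show ?case
    by simp
next
  case (Suc k)
  have v: "\<And>y. v differentiable (at y)" "C_diff k (\<lambda>y. frechet_derivative v (at y) 1)"
    using Suc.prems by (auto simp: Basis_real_def)
  have der: "((\<lambda>x. v (x $ i) *\<^sub>R c) has_derivative
    (\<lambda>h. frechet_derivative v (at (x $ i)) 1 *\<^sub>R (h $ i) *\<^sub>R c)) (at x)" for x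
    by (rule has_derivative_lift_coordinate[OF v(1)])
  have eq: "frechet_derivative (\<lambda>x. v (x $ i) *\<^sub>R c) (at x) =
      (\<lambda>h. frechet_derivative v (at (x $ i)) 1 *\<^sub>R (h $ i) *\<^sub>R c)" for x
    by (rule frechet_derivative_at[OF der, symmetric])
  have "(\<lambda>x. v (x $ i) *\<^sub>R c) differentiable (at x)" for x
    using der differentiable_def by blast
  moreover have "C_diff k (\<lambda>x. frechet_derivative (\<lambda>x. v (x $ i) *\<^sub>R c) (at x) b)" for b
    unfolding eq by (rule Suc.IH[OF v(2)])
  ultimately show ?case
    by simp
qed

text \<open>Fubini gives the integral on \<open>real \<times> real\<close>; the volume-preserving
  coordinate map carries it over to \<open>real ^ 2\<close>.\<close>

lemma mean_zero_shear_flow: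
  assumes cont: "continuous_on UNIV v" and mean: "mean_zero v"
  shows "mean_zero (shear_flow v)"
proof -
  let ?g = "\<lambda>x :: real ^ 2. (x $ 1, x $ 2)" and ?h = "\<lambda>(a, b). vector [a, b] :: real ^ 2"
  have cont2: "continuous_on S (\<lambda>x :: real \<times> real. v (snd x))" for S
    by (intro continuous_on_compose2[OF cont] continuous_intros) auto
  have "integral {0..1} v = 0"
    using mean by (simp add: mean_zero_def Basis_real_def)
  then have "integral (cbox (0, 0) (1, 1)) (\<lambda>x :: real \<times> real. v (snd x)) = 0"
    using integral_prod_continuous[OF cont2] by simp
  then have "((\<lambda>x :: real \<times> real. v (snd x)) has_integral 0) (cbox (0, 0) (1, 1))"
    using integrable_integral[OF integrable_continuous[OF cont2]] by metis
  \<comment> \<open>From here on the premises of \<open>has_integral_twiddle\<close> are collected: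
    both maps send boxes to boxes, and \<open>?g\<close> scales content by 1.\<close>
  moreover have g_box: "?g ` cbox u w = cbox (?g u) (?g w)" for u w
  proof -
    have "(a, b) \<in> ?g ` cbox u w" if "(a, b) \<in> cbox (?g u) (?g w)" for a b
      using that by (intro image_eqI[of _ _ "vector [a, b]"]) (auto simp: mem_box_cart forall_2)
    then show ?thesis
      by (auto simp: mem_box_cart forall_2)
  qed
  moreover have h_box: "?h ` cbox u w = cbox (?h u) (?h w)" for u w
  proof (cases u; cases w)
    fix a b c d :: real
    assume [simp]: "u = (a, b)" "w = (c, d)"
    have "x \<in> ?h ` cbox u w" if "x \<in> cbox (?h u) (?h w)" for x
      using that by (intro image_eqI[of _ _ "(x $ 1, x $ 2)"])
        (auto simp: mem_box_cart forall_2 vec_eq_iff cbox_Pair_eq)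
    then show ?thesis
      by (auto simp: mem_box_cart forall_2 cbox_Pair_eq)
  qed
  moreover have "measure lborel (?g ` cbox u w) = 1 * measure lborel (cbox u w)" for u w
  proof (cases "cbox u w = {}")
    case False
    then have "u $ 1 \<le> w $ 1" "u $ 2 \<le> w $ 2"
      by (auto simp: interval_ne_empty_cart forall_2)
    with False show ?thesis
      unfolding g_box by (simp add: content_Pair content_cbox_cart UNIV_2)
  qed simp
  ultimately have "((\<lambda>x. v (snd (?g x))) has_integral (1 / 1) *\<^sub>R 0) (?h ` cbox (0, 0) (1, 1))"
    by (intro has_integral_twiddle[where g = ?g and h = ?h])
      (auto simp: vec_eq_iff forall_2 intro!: continuous_intros)
  moreover have "?h ` cbox (0, 0) (1, 1) = cbox 0 (\<Sum>b\<in>Basis. b)"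
  proof -
    have "(\<Sum>b\<in>Basis. b :: real ^ 2) $ i = 1" for i
      unfolding cart_eq_inner_axis by (simp add: axis_in_Basis_iff)
    then have "?h (0, 0) = 0" "?h (1, 1) = (\<Sum>b\<in>Basis. b)"
      by (auto simp: vec_eq_iff forall_2 simp del: sum_component)
    then show ?thesis
      unfolding h_box by simp
  qed
  ultimately have "((\<lambda>x :: real ^ 2. v (x $ 2)) has_integral 0) (cbox 0 (\<Sum>b\<in>Basis. b))"
    by simp
  from integral_unique[OF has_integral_scaleR_left[OF this]] show ?thesis
    unfolding mean_zero_def shear_flow_eq by simp
qed

lemma Zn_periodic_of_coordinate:
  fixes g :: "real \<Rightarrow> 'b"
  assumes "\<And>y (k::int). g (y + of_int k) = g y"
  shows "Zn_periodic (\<lambda>x :: real ^ 'm. g (x $ i))"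
  unfolding Zn_periodic_def
proof (intro allI impI)
  fix x k :: "real ^ 'm"
  assume "\<forall>b\<in>Basis. k \<bullet> b \<in> \<int>"
  then have "k $ i \<in> \<int>"
    by (metis axis_in_Basis_iff cart_eq_inner_axis Basis_real_def insertI1)
  then show "g ((x + k) $ i) = g (x $ i)"
    using assms by (auto elim!: Ints_cases)
qed

lemma Zn_periodic_real_iff:
  fixes v :: "real \<Rightarrow> 'b"
  shows "Zn_periodic v \<longleftrightarrow> (\<forall>y (k::int). v (y + of_int k) = v y)"
  by (auto simp: Zn_periodic_def Basis_real_def elim!: Ints_cases)

lemma periodic_flow_shear_flow:
  assumes smooth: "C_infinity v" and per: "Zn_periodic v" and mean: "mean_zero v"
  shows "periodic_flow (shear_flow v)"
  unfolding periodic_flow_def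
proof (intro conjI allI)
  show "C_infinity (shear_flow v)"
    using smooth C_diff_lift_coordinate unfolding C_infinity_def shear_flow_eq by blast
  have "C_diff 0 v" "C_diff (Suc 0) v"
    using smooth unfolding C_infinity_def by blast+
  then have v: "continuous_on UNIV v" "\<And>y. v differentiable (at y)"
    by auto
  show "mean_zero (shear_flow v)"
    using v(1) mean by (rule mean_zero_shear_flow)
  show "Zn_periodic (shear_flow v)"
    unfolding shear_flow_eq
    using per by (intro Zn_periodic_of_coordinate) (simp add: Zn_periodic_real_iff)
  show "divergence (shear_flow v) x = 0" for x
  proof -
    have "frechet_derivative (shear_flow v) (at x) =
        (\<lambda>h. frechet_derivative v (at (x $ 2)) 1 *\<^sub>R (h $ 2) *\<^sub>R axis 1 1)"
      using frechet_derivative_at[OF has_derivative_lift_coordinate[OF v(2)]] unfolding shear_flow_eq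
      by metis
    \<comment> \<open>The field points along the first axis and varies only along the second, so
      every diagonal entry of its derivative has a zero factor.\<close>
    moreover have "b $ 2 * (axis 1 1 \<bullet> b) = 0" if b: "b \<in> Basis" for b :: "real ^ 2"
    proof -
      obtain i where "b = axis i 1"
        using b by (auto simp: Basis_vec_def)
      then show ?thesis
        by (cases "i = 1") (simp_all add: inner_axis_axis, simp add: axis_def)
    qed
    ultimately show ?thesis
      unfolding divergence_def by (intro sum.neutral) auto
  qed
qed

section \<open>The cell problem of a shear flow\<close>

lemma GDERIV_along_axis:
  fixes \<phi> :: "real ^ 'm \<Rightarrow> real"
  assumes "GDERIV \<phi> x :> d"
  shows "((\<lambda>t. \<phi> (x + (t - x $ i) *\<^sub>R axis i 1)) has_real_derivative d $ i) (at (x $ i))"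
proof -
  \<comment> \<open>The line is parametrised by the coordinate itself, with base point
    \<open>x $ i\<close>, to match the test-function properties of the eikonal solution.\<close>
  have "((\<lambda>t. x + (t - x $ i) *\<^sub>R axis i 1) has_derivative (\<lambda>t. t *\<^sub>R axis i 1)) (at (x $ i))"
    by (auto intro!: derivative_eq_intros)
  moreover have "(\<phi> has_derivative (\<lambda>h. h \<bullet> d)) (at (x + (x $ i - x $ i) *\<^sub>R axis i 1))"
    using assms by (simp add: gderiv_def)
  ultimately have "((\<lambda>t. \<phi> (x + (t - x $ i) *\<^sub>R axis i 1)) has_derivative (\<lambda>t. (t *\<^sub>R axis i 1) \<bullet> d)) (at (x $ i))"
    by (rule has_derivative_compose)
  moreover have "(\<lambda>t. (t *\<^sub>R axis i 1) \<bullet> d) = (\<lambda>t. d $ i * t)"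
    by (simp add: fun_eq_iff inner_axis' mult.commute)
  ultimately show ?thesis
    by (simp add: has_field_derivative_def)
qed

lemma eventually_along_axis:
  fixes x :: "real ^ 'm"
  assumes "\<forall>\<^sub>F y in nhds x. P y"
  shows "\<forall>\<^sub>F t in nhds (x $ i). P (x + (t - x $ i) *\<^sub>R axis i 1)"
proof -
  have "((\<lambda>t. x + (t - x $ i) *\<^sub>R axis i 1) \<longlongrightarrow> x + (x $ i - x $ i) *\<^sub>R axis i 1) (nhds (x $ i))"
    by (intro tendsto_intros filterlim_ident)
  then have "filterlim (\<lambda>t. x + (t - x $ i) *\<^sub>R axis i 1) (nhds x) (nhds (x $ i))"
    by simp
  then show ?thesis
    using assms by (simp add: filterlim_iff)
qed

lemma deriv_eq_0_local_min:
  fixes c :: "real \<Rightarrow> real"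
  assumes "(c has_real_derivative c') (at x)" "\<forall>\<^sub>F t in nhds x. c x \<le> c t"
  shows "c' = 0"
  using deriv_nonneg_along[OF assms(1) eventually_along[OF assms(2)], of 1]
    deriv_nonneg_along[OF assms(1) eventually_along[OF assms(2)], of "- 1"] by simp

lemma norm_vector_2: "norm (vector [a, b] :: real ^ 2) = sqrt (a\<^sup>2 + b\<^sup>2)"
  by (simp add: norm_vec_def L2_set_def sum_2)

text \<open>The solution is \<open>g (x $ 2)\<close> with \<open>g\<close> solving |g'| = h. It is
  constant along the first axis, so test gradients have first component 0 and the Hamiltonian is
  nondecreasing in the absolute value of the second. Replacing that value by \<open>h\<close> turns
  it into \<open>c\<close>.\<close>

lemma shear_cell_solution:
  fixes v h :: "real \<Rightarrow> real"
  assumes N: "mono_on {0..} N"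
    and h: "continuous_on UNIV h" "\<And>y. h (y + 1) = h y" "\<And>y. h y \<ge> 0" "h y\<^sub>0 = 0"
    and eq: "\<And>y. N (sqrt (s\<^sup>2 + (h y)\<^sup>2)) + A * (v y * s) = c"
  obtains G where "continuous_on UNIV G" "Zn_periodic G"
    "viscosity_sub (ham N A (shear_flow v) (vector [s, 0])) c G"
    "viscosity_super (ham N A (shear_flow v) (vector [s, 0])) c G"
proof -
  obtain g where g: "continuous_on UNIV g" "\<And>y (k::int). g (y + of_int k) = g y"
    "\<And>y \<phi> d. (\<phi> has_real_derivative d) (at y) \<Longrightarrow>
       \<forall>\<^sub>F x in nhds y. g x - \<phi> x \<le> g y - \<phi> y \<Longrightarrow> \<bar>d\<bar> \<le> h y"
    "\<And>y \<phi> d. (\<phi> has_real_derivative d) (at y) \<Longrightarrow>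
       \<forall>\<^sub>F x in nhds y. g x - \<phi> x \<ge> g y - \<phi> y \<Longrightarrow> \<bar>d\<bar> \<ge> h y"
    using periodic_eikonal_solution[OF h] by blast
  have ham_eq: "ham N A (shear_flow v) (vector [s, 0]) x d =
      N (sqrt (s\<^sup>2 + (d $ 2)\<^sup>2)) + A * (v (x $ 2) * s)" if "d $ 1 = 0" for x d
  proof -
    have "vector [s, 0] + d = vector [s, d $ 2]"
      using that by (simp add: vec_eq_iff forall_2)
    then show ?thesis
      by (simp add: ham_def norm_vector_2 shear_flow_def inner_vec_def sum_2)
  qed
  let ?G = "\<lambda>x :: real ^ 2. g (x $ 2)"
  show thesis
  proof (rule that[of ?G])
    show "continuous_on UNIV ?G"
      by (intro continuous_on_compose2[OF g(1)] continuous_intros) auto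
    show "Zn_periodic ?G"
      by (rule Zn_periodic_of_coordinate[OF g(2)])
    show "viscosity_sub (ham N A (shear_flow v) (vector [s, 0])) c ?G"
      unfolding viscosity_sub_def
    proof (intro allI impI, elim conjE)
      fix \<phi> D and x :: "real ^ 2"
      assume D: "\<forall>x. GDERIV \<phi> x :> D x"
        and max: "\<forall>\<^sub>F y in nhds x. g (y $ 2) - \<phi> y \<le> g (x $ 2) - \<phi> x"
      have "D x $ 1 = 0"
        by (rule deriv_eq_0_local_min[OF GDERIV_along_axis[OF D[rule_format]]])
          (use eventually_along_axis[OF max, of 1] in \<open>simp add: axis_def\<close>)
      moreover have "\<bar>D x $ 2\<bar> \<le> h (x $ 2)"
        by (rule g(3)[OF GDERIV_along_axis[OF D[rule_format]]])
          (use eventually_along_axis[OF max, of 2] in \<open>simp add: axis_def\<close>)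
      then have "s\<^sup>2 + (D x $ 2)\<^sup>2 \<le> s\<^sup>2 + (h (x $ 2))\<^sup>2"
        using abs_le_square_iff h(3) by (metis abs_of_nonneg add_le_cancel_left)
      then have "N (sqrt (s\<^sup>2 + (D x $ 2)\<^sup>2)) \<le> N (sqrt (s\<^sup>2 + (h (x $ 2))\<^sup>2))"
        by (intro mono_onD[OF N]) auto
      ultimately show "ham N A (shear_flow v) (vector [s, 0]) x (D x) \<le> c"
        using eq[of "x $ 2"] by (simp add: ham_eq)
    qed
    show "viscosity_super (ham N A (shear_flow v) (vector [s, 0])) c ?G"
      unfolding viscosity_super_def
    proof (intro allI impI, elim conjE)
      fix \<phi> D and x :: "real ^ 2"
      assume D: "\<forall>x. GDERIV \<phi> x :> D x"
        and min: "\<forall>\<^sub>F y in nhds x. g (y $ 2) - \<phi> y \<ge> g (x $ 2) - \<phi> x"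
      have "- (D x $ 1) = 0"
        by (rule deriv_eq_0_local_min[OF DERIV_minus[OF GDERIV_along_axis[OF D[rule_format]]]])
          (use eventually_along_axis[OF min, of 1] in \<open>simp add: axis_def\<close>)
      then have "D x $ 1 = 0"
        by simp
      moreover have "\<bar>D x $ 2\<bar> \<ge> h (x $ 2)"
        by (rule g(4)[OF GDERIV_along_axis[OF D[rule_format]]])
          (use eventually_along_axis[OF min, of 2] in \<open>simp add: axis_def\<close>)
      then have "s\<^sup>2 + (D x $ 2)\<^sup>2 \<ge> s\<^sup>2 + (h (x $ 2))\<^sup>2"
        using abs_le_square_iff h(3) by (metis abs_of_nonneg add_le_cancel_left)
      then have "N (sqrt (s\<^sup>2 + (D x $ 2)\<^sup>2)) \<ge> N (sqrt (s\<^sup>2 + (h (x $ 2))\<^sup>2))"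
        by (intro mono_onD[OF N]) auto
      ultimately show "ham N A (shear_flow v) (vector [s, 0]) x (D x) \<ge> c"
        using eq[of "x $ 2"] by (simp add: ham_eq)
    qed
  qed
qed

text \<open>A periodic solution of |g'| = h requires a zero of \<open>h\<close>, as seen at a
  minimum of \<open>g\<close>. This fixes the constant: it is the least one for which the cell
  equation can be solved for a real \<open>h\<close>, and then \<open>h\<close> vanishes where
  \<open>v\<close> is maximal.\<close>

lemma
  fixes v :: "real \<Rightarrow> real"
  assumes v: "continuous_on UNIV v" "Zn_periodic v" and A: "A > 0"
  shows is_alpha_shear_flow: "is_alpha A (shear_flow v) (vector [1, 0]) (1 + A * (SUP y. v y))" (is ?\<alpha>)
    and is_beta_shear_flow:
      "s > 0 \<Longrightarrow> is_beta A (shear_flow v) (vector [s, 0]) (s\<^sup>2 + A * (SUP y. v y) * s)" (is "_ \<Longrightarrow> ?\<beta>")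
proof -
  obtain y\<^sub>0 where y\<^sub>0: "\<And>y. v y \<le> v y\<^sub>0"
    using continuous_Zn_periodic_attains_sup[OF v] by blast
  define M where "M = (SUP y. v y)"
  have M: "M = v y\<^sub>0"
    unfolding M_def by (rule cSup_eq_maximum) (use y\<^sub>0 in auto)
  have le: "A * v y \<le> A * M" for y
    using y\<^sub>0 A by (simp add: M)
  have per: "v (y + 1) = v y" for y
    using v(2)[unfolded Zn_periodic_real_iff] of_int_1 by metis
  show ?\<alpha>
  proof -
    \<comment> \<open>Obtained by solving
      \<open>sqrt (1 + (h y)\<^sup>2) + A * v y = 1 + A * M\<close> for \<open>h y\<close>.\<close>
    define h where "h y = sqrt ((1 + (A * M - A * v y))\<^sup>2 - 1)" for y
    have ge: "(1 + (A * M - A * v y))\<^sup>2 \<ge> 1" for y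
      using le[of y] by (intro one_le_power) simp
    have "sqrt (1 + (h y)\<^sup>2) = 1 + (A * M - A * v y)" for y
      using ge[of y] le[of y] by (simp add: h_def)
    then have "(\<lambda>r. r) (sqrt (1\<^sup>2 + (h y)\<^sup>2)) + A * (v y * 1) = 1 + A * M" for y
      by simp
    moreover have "continuous_on UNIV h"
      unfolding h_def by (intro continuous_intros v(1))
    moreover have "mono_on {0..} (\<lambda>r::real. r)"
      by (simp add: mono_on_def)
    moreover have "h (y + 1) = h y" "h y \<ge> 0" "h y\<^sub>0 = 0" for y
      using ge by (auto simp: h_def per M)
    ultimately obtain G where G: "continuous_on UNIV G" "Zn_periodic G"
      "viscosity_sub (ham (\<lambda>r. r) A (shear_flow v) (vector [1, 0])) (1 + A * M) G"
      "viscosity_super (ham (\<lambda>r. r) A (shear_flow v) (vector [1, 0])) (1 + A * M) G"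
      using shear_cell_solution[of "\<lambda>r. r" h y\<^sub>0 1 A v "1 + A * M"] by blast
    have "viscosity_sub (ham (\<lambda>r. r) A (shear_flow v) (vector [1, 0])) (1 + A * M + \<epsilon>) G"
      "viscosity_super (ham (\<lambda>r. r) A (shear_flow v) (vector [1, 0])) (1 + A * M - \<epsilon>) G"
      if "\<epsilon> > 0" for \<epsilon>
    proof -
      show "viscosity_sub (ham (\<lambda>r. r) A (shear_flow v) (vector [1, 0])) (1 + A * M + \<epsilon>) G"
        using G(3) that unfolding viscosity_sub_def
        by (meson add_increasing2 less_imp_le order_trans order_refl)
      show "viscosity_super (ham (\<lambda>r. r) A (shear_flow v) (vector [1, 0])) (1 + A * M - \<epsilon>) G"
        using G(4) that unfolding viscosity_super_def by (smt (verit))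
    qed
    with G(1,2) show ?\<alpha>
      unfolding is_alpha_def G_hamiltonian_eq_ham M_def by blast
  qed
  show ?\<beta> if s: "s > 0"
  proof -
    \<comment> \<open>Obtained by solving \<open>s\<^sup>2 + (h y)\<^sup>2 + A * v y * s = s\<^sup>2
      + A * M * s\<close> for \<open>h y\<close>.\<close>
    define h where "h y = sqrt (s * (A * M - A * v y))" for y
    have ge: "s * (A * M - A * v y) \<ge> 0" for y
      using le[of y] s by simp
    have "(sqrt (s\<^sup>2 + (h y)\<^sup>2))\<^sup>2 = s\<^sup>2 + s * (A * M - A * v y)" for y
      using ge[of y] by (simp add: h_def)
    then have "(\<lambda>r. r\<^sup>2) (sqrt (s\<^sup>2 + (h y)\<^sup>2)) + A * (v y * s) = s\<^sup>2 + A * M * s" for y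
      by (simp add: algebra_simps)
    moreover have "continuous_on UNIV h"
      unfolding h_def by (intro continuous_intros v(1))
    moreover have "mono_on {0..} (\<lambda>r::real. r\<^sup>2)"
      by (simp add: mono_on_def power_mono)
    moreover have "h (y + 1) = h y" "h y \<ge> 0" "h y\<^sub>0 = 0" for y
      using ge by (auto simp: h_def per M)
    ultimately obtain G where "continuous_on UNIV G" "Zn_periodic G"
      "viscosity_sub (ham (\<lambda>r. r\<^sup>2) A (shear_flow v) (vector [s, 0])) (s\<^sup>2 + A * M * s) G"
      "viscosity_super (ham (\<lambda>r. r\<^sup>2) A (shear_flow v) (vector [s, 0])) (s\<^sup>2 + A * M * s) G"
      using shear_cell_solution[of "\<lambda>r. r\<^sup>2" h y\<^sub>0 s A v "s\<^sup>2 + A * M * s"] by blast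
    then show ?\<beta>
      unfolding is_beta_def F_hamiltonian_eq_ham M_def by blast
  qed
qed

section \<open>Flame speeds and the threshold 1/4\<close>

lemma INF_quadratic_speed:
  fixes m a :: real
  assumes "m > 0"
  shows "(INF s\<in>{0<..}. (m + (s\<^sup>2 + a * s)) / s) = a + 2 * sqrt m"
proof (rule cInf_eq_minimum)
  \<comment> \<open>The infimum is attained: \<open>sqrt m\<close> minimises
    \<open>m / s + s\<close>.\<close>
  have "(m + ((sqrt m)\<^sup>2 + a * sqrt m)) / sqrt m = a + 2 * sqrt m"
    using assms by (simp add: field_simps)
  then show "a + 2 * sqrt m \<in> (\<lambda>s. (m + (s\<^sup>2 + a * s)) / s) ` {0<..}"
    using assms by (intro image_eqI[of _ _ "sqrt m"]) auto
next
  fix x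
  assume "x \<in> (\<lambda>s. (m + (s\<^sup>2 + a * s)) / s) ` {0<..}"
  then obtain s where s: "s > 0" "x = (m + (s\<^sup>2 + a * s)) / s"
    by auto
  \<comment> \<open>The inequality of arithmetic and geometric means for \<open>m\<close> and
    \<open>s\<^sup>2\<close>, multiplied out.\<close>
  have "(sqrt m - s)\<^sup>2 = m + s\<^sup>2 - 2 * sqrt m * s"
    using assms by (simp add: power2_diff)
  then have "2 * sqrt m * s \<le> m + s\<^sup>2"
    using zero_le_power2[of "sqrt m - s"] by linarith
  then have "(a + 2 * sqrt m) * s \<le> m + (s\<^sup>2 + a * s)"
    by (simp add: algebra_simps)
  then show "a + 2 * sqrt m \<le> x"
    using s by (simp add: pos_le_divide_eq)
qed

text \<open>The KPP bound is evaluated at \<open>1 / 2\<close>. Positivity places the minimiser, the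
  square root of f'(0), in the range \<open>s > 0\<close>.\<close>

lemma KPP_deriv_pos:
  assumes "KPP f"
  shows "deriv01 f 0 > 0"
proof -
  have "0 < f (1 / 2) \<and> f (1 / 2) \<le> 1 / 2 * deriv01 f 0"
    using assms unfolding KPP_def by (metis divide_less_eq_1_pos greaterThanLessThan_iff one_less_numeral_iff
        semiring_norm(76) zero_less_divide_1_iff zero_less_numeral)
  then show ?thesis
    by linarith
qed

text \<open>The function \<open>\<beta>\<close> in \<open>is_gamma\<close> is existentially
  quantified, but uniqueness fixes its values at every \<open>s > 0\<close>, the range of the
  infimum.\<close>

lemma is_gamma_shear_flow_iff:
  assumes "C_infinity v" "Zn_periodic v" "mean_zero v" and A: "A > 0" and f: "deriv01 f 0 > 0"
  shows "is_gamma f A (shear_flow v) (vector [1, 0]) \<gamma> \<longleftrightarrow>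
    \<gamma> = A * (SUP y. v y) + 2 * sqrt (deriv01 f 0)"
proof -
  have "C_diff 0 v"
    using assms(1) unfolding C_infinity_def by blast
  then have cont: "continuous_on UNIV v"
    by simp
  have flow: "periodic_flow (shear_flow v)"
    using assms(1-3) by (rule periodic_flow_shear_flow)
  have "s *\<^sub>R vector [1, 0] = (vector [s, 0] :: real ^ 2)" for s :: real
    by (simp add: vec_eq_iff forall_2)
  then have beta: "is_beta A (shear_flow v) (s *\<^sub>R vector [1, 0]) b \<longleftrightarrow> b = s\<^sup>2 + A * (SUP y. v y) * s"
    if "s > 0" for s b
    using is_beta_shear_flow[OF cont assms(2) A that] is_beta_unique[OF flow A] by metis
  have INF: "(INF s\<in>{0<..}. (deriv01 f 0 + \<beta> s) / s) = A * (SUP y. v y) + 2 * sqrt (deriv01 f 0)"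
    if "\<And>s. s > 0 \<Longrightarrow> \<beta> s = s\<^sup>2 + A * (SUP y. v y) * s" for \<beta>
    using INF_quadratic_speed[OF f, of "A * (SUP y. v y)"] that
    by (simp cong: INF_cong_simp)
  show ?thesis
    unfolding is_gamma_def using beta INF INF[of "\<lambda>s. s\<^sup>2 + A * (SUP y. v y) * s"] by auto
qed

lemma is_alpha_le_is_gamma:
  fixes V :: "real ^ 'n \<Rightarrow> real ^ 'n"
  assumes "periodic_flow V" "A > 0" "deriv01 f 0 \<ge> 1 / 4" "is_alpha A V p \<alpha>" "is_gamma f A V p \<gamma>"
  shows "\<alpha> \<le> \<gamma>"
proof -
  obtain \<beta> where \<beta>: "\<And>s. s > 0 \<Longrightarrow> is_beta A V (s *\<^sub>R p) (\<beta> s)"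
    and \<gamma>: "\<gamma> = (INF s\<in>{0<..}. (deriv01 f 0 + \<beta> s) / s)"
    using assms(5) unfolding is_gamma_def by blast
  have "\<alpha> \<le> (deriv01 f 0 + \<beta> s) / s" if "s > 0" for s
    using is_alpha_le_F_speed[OF assms(1,2) that assms(3,4) \<beta>[OF that]] .
  then show ?thesis
    unfolding \<gamma> by (intro cINF_greatest) auto
qed

theorem mainTheorem3:
  fixes f :: "real \<Rightarrow> real" and A :: real
  assumes "KPP f" and "A > 0"
  shows "(\<forall>(V :: real ^ 'n \<Rightarrow> real ^ 'n) p \<alpha> \<gamma>.
            periodic_flow V \<and> deriv01 f 0 \<ge> 1 / 4 \<and> is_alpha A V p \<alpha> \<and> is_gamma f A V p \<gamma>
            \<longrightarrow> \<gamma> \<ge> \<alpha>)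
       \<and> (\<forall>v :: real \<Rightarrow> real. C_infinity v \<and> Zn_periodic v \<and> mean_zero v \<longrightarrow>
            (let V = shear_flow v; p = vector [1, 0] :: real ^ 2; M = (SUP y. v y) in
              periodic_flow V \<and>
              (\<forall>\<alpha>. is_alpha A V p \<alpha> \<longleftrightarrow> \<alpha> = 1 + A * M) \<and>
              (\<forall>\<gamma>. is_gamma f A V p \<gamma> \<longleftrightarrow> \<gamma> = A * M + 2 * sqrt (deriv01 f 0)) \<and>
              (deriv01 f 0 < 1 / 4 \<longrightarrow>
                (\<forall>\<alpha> \<gamma>. is_alpha A V p \<alpha> \<and> is_gamma f A V p \<gamma> \<longrightarrow> \<gamma> < \<alpha>))))"
proof (intro conjI allI impI; (elim conjE)?)
  show "\<alpha> \<le> \<gamma>" if "periodic_flow V" "deriv01 f 0 \<ge> 1 / 4" "is_alpha A V p \<alpha>" "is_gamma f A V p \<gamma>"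
    for V :: "real ^ 'n \<Rightarrow> real ^ 'n" and p \<alpha> \<gamma>
    using is_alpha_le_is_gamma that \<open>A > 0\<close> by blast
next
  fix v :: "real \<Rightarrow> real"
  assume v: "C_infinity v" "Zn_periodic v" "mean_zero v"
  have "C_diff 0 v"
    using v(1) unfolding C_infinity_def by blast
  then have cont: "continuous_on UNIV v"
    by simp
  have flow: "periodic_flow (shear_flow v)"
    using v by (rule periodic_flow_shear_flow)
  have alpha: "is_alpha A (shear_flow v) (vector [1, 0]) \<alpha> \<longleftrightarrow> \<alpha> = 1 + A * (SUP y. v y)" for \<alpha>
    using is_alpha_shear_flow[OF cont v(2) \<open>A > 0\<close>] is_alpha_unique[OF flow \<open>A > 0\<close>] by metis
  have gamma: "is_gamma f A (shear_flow v) (vector [1, 0]) \<gamma> \<longleftrightarrow>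
      \<gamma> = A * (SUP y. v y) + 2 * sqrt (deriv01 f 0)" for \<gamma>
    using is_gamma_shear_flow_iff[OF v \<open>A > 0\<close> KPP_deriv_pos[OF \<open>KPP f\<close>]] .
  \<comment> \<open>The two shear speeds differ by 1 minus this quantity, which reaches 1 exactly
    when f'(0) = 1/4.\<close>
  have "2 * sqrt (deriv01 f 0) < 1" if "deriv01 f 0 < 1 / 4"
    using real_sqrt_less_mono[OF that] by (simp add: real_sqrt_divide)
  then show "let V = shear_flow v; p = vector [1, 0] :: real ^ 2; M = (SUP y. v y) in
              periodic_flow V \<and>
              (\<forall>\<alpha>. is_alpha A V p \<alpha> \<longleftrightarrow> \<alpha> = 1 + A * M) \<and>
              (\<forall>\<gamma>. is_gamma f A V p \<gamma> \<longleftrightarrow> \<gamma> = A * M + 2 * sqrt (deriv01 f 0)) \<and>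
              (deriv01 f 0 < 1 / 4 \<longrightarrow>
                (\<forall>\<alpha> \<gamma>. is_alpha A V p \<alpha> \<and> is_gamma f A V p \<gamma> \<longrightarrow> \<gamma> < \<alpha>))"
    unfolding Let_def alpha gamma using flow by auto
qed

end
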